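(* Let $(\vec{G},c)$ be a finite weighted symmetric digraph and let $L(\vec{G},c)=\max\{c_{xy}+c_{yx} : xy \text{ an arc of } \vec{G}\}$. Suppose $r$ is a real number with $r\geq L(\vec{G},c)$. Then $(\vec{G},c)$ has a circular $r$-coloring if and only if $(\vec{G},c)$ has a breaker function $T$ such that $$\max_{C}\frac{|C|_c}{|C|_T}\leq r,$$ where the maximum is taken over all dicycles $C$ of $\vec{G}$ satisfying $0<|C|_c \pmod r < L(\vec{G},c)$.
   Context: A weighted digraph $(\vec{G},c)$ is a digraph $\vec{G}$ together with a function $c$ assigning to each arc $uv$ a positive real number $c_{uv}$. It is a weighted symmetric digraph if for every pair of vertices $u,v$, either both arcs $uv$ and $vu$ exist or neither does. A dicycle is a closed directed walk $(v_1,\dots,v_{k+1})$ with $v_1,\dots,v_k$ distinct, $v_1=v_{k+1}$, and each $v_iv_{i+1}$ an arc. A breaker function of a weighted symmetric digraph is a function $T$ from the arc set to $\{0,1\}$ with $T_{xy}+T_{yx}=1$ for every arc $xy$. For a dicycle $C$ with arc set $E(C)$, $|C|_T=\sum_{uv\in E(C)}T_{uv}$ and $|C|_c=\sum_{uv\in E(C)}c_{uv}$. A quotient with zero denominator is considered to be $+\infty$. For reals $x$ and $r>0$, $x \pmod r$ denotes the unique $t\in[0,r)$ with $t\equiv x \pmod r$. For $p>0$, identify the circle $S^p$ of perimeter $p$ with $[0,p)$; for $x,y\in S^p$, $d_p(x,y)$ is the length of the clockwise arc from $x$ to $y$ (i.e. $(y-x)\pmod p$), with $d_p(x,x)=0$.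 A circular $p$-coloring of $(\vec{G},c)$ is a map $\varphi:V(\vec{G})\to S^p$ such that $d_p(\varphi(u),\varphi(v))\geq c_{uv}$ for every arc $uv$. *)

theory Defs
  imports
    Complex_Main
    "HOL-Library.Extended_Real"
    "HOL-Library.Real_Mod"
    "Graph_Theory.Pair_Digraph"
begin

(* pair_pseudo_graph: finite, symmetric, no parallel arcs; loops are not excluded. *)
locale weighted_sym_digraph = pair_pseudo_graph G
  for G :: "'a pair_pre_digraph" +
  fixes c :: "'a \<times> 'a \<Rightarrow> real"
  assumes weight_pos: "e \<in> parcs G \<Longrightarrow> 0 < c e"

(* Max {} is unspecified; for an arcless digraph the maximum is taken to be 0. *)
definition max_digon_weight :: "'a pair_pre_digraph \<Rightarrow> ('a \<times> 'a \<Rightarrow> real) \<Rightarrow> real" where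
  "max_digon_weight G c =
     (if parcs G = {} then 0 else Max {c (x, y) + c (y, x) | x y. (x, y) \<in> parcs G})"

definition breaker_function :: "'a pair_pre_digraph \<Rightarrow> ('a \<times> 'a \<Rightarrow> nat) \<Rightarrow> bool" where
  "breaker_function G T \<longleftrightarrow>
     (\<forall>e \<in> parcs G. T e \<in> {0, 1}) \<and> (\<forall>(x, y) \<in> parcs G. T (x, y) + T (y, x) = 1)"

(* A dicycle is represented by its list of arcs as in pre_digraph.cycle. Digons u, v, u
   count as dicycles; rotations of the list give the same arc set. *)
abbreviation dicycle :: "'a pair_pre_digraph \<Rightarrow> ('a \<times> 'a) awalk \<Rightarrow> bool" where
  "dicycle G \<equiv> pre_digraph.cycle (with_proj G)"

definition arc_total :: "('a \<times> 'a \<Rightarrow> 'b::comm_monoid_add) \<Rightarrow> ('a \<times> 'a) awalk \<Rightarrow> 'b" where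
  "arc_total w C = (\<Sum>e \<in> set C. w e)"

definition dicycle_ratio ::
  "('a \<times> 'a \<Rightarrow> real) \<Rightarrow> ('a \<times> 'a \<Rightarrow> nat) \<Rightarrow> ('a \<times> 'a) awalk \<Rightarrow> ereal" where
  "dicycle_ratio c T C =
     (if arc_total T C = 0 then \<infinity> else ereal (arc_total c C / real (arc_total T C)))"

(* The circle of perimeter p is {0..<p}; for p > 0 the value of _ rmod p lies in {0..<p}. *)
definition circ_dist :: "real \<Rightarrow> real \<Rightarrow> real \<Rightarrow> real" where
  "circ_dist p x y = (y - x) rmod p"

definition circular_coloring ::
  "'a pair_pre_digraph \<Rightarrow> ('a \<times> 'a \<Rightarrow> real) \<Rightarrow> real \<Rightarrow> ('a \<Rightarrow> real) \<Rightarrow> bool" where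
  "circular_coloring G c p \<phi> \<longleftrightarrow>
     (\<forall>v \<in> pverts G. \<phi> v \<in> {0..<p}) \<and>
     (\<forall>(u, v) \<in> parcs G. circ_dist p (\<phi> u) (\<phi> v) \<ge> c (u, v))"

end

theory Submission
  imports Defs
begin

text \<open>
  A coloring \<open>\<phi>\<close> gives the breaker function with \<open>T (u, v) = 1\<close> iff \<open>\<phi> u > \<phi> v\<close>;
  then \<open>c e \<le> \<phi> (snd e) - \<phi> (fst e) + r * T e\<close> on every arc \<open>e\<close>, and summing over a
  dicycle telescopes.

  Conversely, weigh the arcs by \<open>w = c - r * T\<close> and choose a spanning branching for which the
  sum of the weights \<open>f v\<close> of the paths from the roots to all vertices \<open>v\<close> is maximal. The coloring is
  \<open>f\<close> modulo \<open>r\<close>. If \<open>v\<close> is not on the path to \<open>u\<close>, then reattaching \<open>v\<close> below \<open>u\<close> shows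
  \<open>f v \<ge> f u + w (u, v)\<close>. If it is, then the path from \<open>v\<close> to \<open>u\<close> closes up with the arc
  \<open>(u, v)\<close> to a dicycle \<open>C\<close>, whose \<open>c\<close>-weight is \<open>f u - f v + c (u, v)\<close> modulo \<open>r\<close>: either the
  hypothesis on \<open>C\<close> yields the same inequality, or this residue is \<open>0\<close> or at least the maximal digon
  weight, which is enough by itself.
\<close>

section \<open>Paths as vertex lists\<close>

fun path_arcs :: "'a list \<Rightarrow> ('a \<times> 'a) list" where
  "path_arcs (x # y # xs) = (x, y) # path_arcs (y # xs)"
| "path_arcs _ = []"

lemma path_arcs_append: "path_arcs (xs @ y # ys) = path_arcs (xs @ [y]) @ path_arcs (y # ys)"
proof (induction xs)
  case (Cons x xs)
  then show ?case by (cases xs) auto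
qed simp

lemma path_arcs_snoc: "xs \<noteq> [] \<Longrightarrow> path_arcs (xs @ [y]) = path_arcs xs @ [(last xs, y)]"
proof (induction xs)
  case (Cons x xs)
  then show ?case by (cases xs) auto
qed simp

lemma pcas_path_arcs: "pcas x (path_arcs (x # xs)) (last (x # xs))"
  by (induction xs arbitrary: x) auto

lemma pawalk_verts_path_arcs: "pawalk_verts x (path_arcs (x # xs)) = x # xs"
  by (induction xs arbitrary: x) auto

lemma sum_list_pcas_telescope:
  fixes \<phi> :: "'a \<Rightarrow> real"
  shows "pcas u p v \<Longrightarrow> (\<Sum>e\<leftarrow>p. \<phi> (snd e) - \<phi> (fst e)) = \<phi> v - \<phi> u"
  by (induction p arbitrary: u) auto

context pair_wf_digraph
begin

lemma cycle_path_arcs: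
  assumes "set (path_arcs (v # vs @ [v])) \<subseteq> parcs G" "v \<notin> set vs" "distinct vs"
  shows "cycle (path_arcs (v # vs @ [v]))"
proof -
  have "v \<in> pverts G"
    using assms(1) by (cases vs) (auto intro: in_arcsD1)
  then show ?thesis
    unfolding cycle_def awalk_def
    using assms pcas_path_arcs[of v "vs @ [v]"] pawalk_verts_path_arcs[of v "vs @ [v]"]
    by (intro exI[of _ v]) (cases vs; auto)
qed

text \<open>The arcs of a dicycle are distinct, so nothing is lost by summing over the set. The list
  form is what telescoping along the walk needs.\<close>

lemma arc_total_cycle:
  assumes "cycle C"
  shows "arc_total w C = (\<Sum>e\<leftarrow>C. w e)"
  using assms unfolding cycle_conv arc_total_def by (metis sum_list_distinct_conv_sum_set)

end

section \<open>Maximal branchings\<close>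

text \<open>\<open>P v\<close> is the path from the root of the tree of \<open>v\<close> to \<open>v\<close>.\<close>

definition branching :: "'a set \<Rightarrow> 'a rel \<Rightarrow> ('a \<Rightarrow> 'a list) \<Rightarrow> bool" where
  "branching V E P \<longleftrightarrow>
     (\<forall>x. x \<notin> V \<longrightarrow> P x = []) \<and>
     (\<forall>x\<in>V. \<exists>A. P x = A @ [x]) \<and>
     (\<forall>x A y B. P x = A @ y # B \<longrightarrow> P y = A @ [y]) \<and>
     (\<forall>x. set (path_arcs (P x)) \<subseteq> E)"

lemma branching_outside: "branching V E P \<Longrightarrow> x \<notin> V \<Longrightarrow> P x = []"
  and branching_last: "branching V E P \<Longrightarrow> x \<in> V \<Longrightarrow> \<exists>A. P x = A @ [x]"
  and branching_prefix: "branching V E P \<Longrightarrow> P x = A @ y # B \<Longrightarrow> P y = A @ [y]"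
  and branching_arcs: "branching V E P \<Longrightarrow> set (path_arcs (P x)) \<subseteq> E"
  unfolding branching_def by blast+

lemma branching_subset:
  assumes "branching V E P"
  shows "set (P x) \<subseteq> V"
proof
  fix y assume "y \<in> set (P x)"
  then obtain A B where "P x = A @ y # B" by (auto dest: split_list)
  then have "P y = A @ [y]" by (rule branching_prefix[OF assms])
  then show "y \<in> V" using branching_outside[OF assms, of y] by auto
qed

text \<open>A repeated vertex \<open>y\<close> would end two prefixes of different length, and both
  would have to be \<open>P y\<close>.\<close>

lemma branching_distinct:
  assumes "branching V E P"
  shows "distinct (P x)"
proof (rule ccontr)
  assume "\<not> distinct (P x)"
  then obtain A y B D where "P x = A @ [y] @ B @ [y] @ D"
    using not_distinct_decomp by blast
  then have "P x = A @ y # (B @ y # D)" "P x = (A @ y # B) @ y # D"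
    by auto
  then have "P y = A @ [y]" "P y = (A @ y # B) @ [y]"
    using branching_prefix[OF assms] by blast+
  then show False by simp
qed

lemma branching_singletons: "branching V E (\<lambda>x. if x \<in> V then [x] else [])"
  unfolding branching_def by (auto simp: Cons_eq_append_conv split: if_splits)

text \<open>There are only finitely many distinct lists over \<open>V\<close>, and outside
  \<open>V\<close> the value is fixed as \<open>[]\<close>. This makes a maximal branching
  available.\<close>

lemma finite_branchings:
  assumes "finite V"
  shows "finite {P. branching V E P}"
proof (rule finite_subset)
  show "finite {P. \<forall>x. (x \<in> V \<longrightarrow> P x \<in> {xs. set xs \<subseteq> V \<and> distinct xs}) \<and> (x \<notin> V \<longrightarrow> P x = [])}"
    using assms by (intro finite_set_of_finite_funs finite_subset_distinct)
qed (auto dest: branching_distinct branching_subset branching_outside)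

text \<open>The whole subtree at \<open>v\<close> moves along: only the part of a path before
  \<open>v\<close> is exchanged, for \<open>P u\<close>.\<close>

definition reattach :: "('a \<Rightarrow> 'a list) \<Rightarrow> 'a \<Rightarrow> 'a \<Rightarrow> 'a \<Rightarrow> 'a list" where
  "reattach P u v x =
     (if v \<in> set (P x) then P u @ dropWhile (\<lambda>y. y \<noteq> v) (P x) else P x)"

lemma reattach_below:
  "P x = A @ v # B \<Longrightarrow> v \<notin> set A \<Longrightarrow> reattach P u v x = P u @ v # B"
  unfolding reattach_def by (auto simp: dropWhile_append3)

lemma reattach_not_below: "v \<notin> set (P x) \<Longrightarrow> reattach P u v x = P x"
  unfolding reattach_def by auto

text \<open>As \<open>v\<close> is not on \<open>P u\<close>, the vertex \<open>u\<close> lies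
  outside the moved subtree, so no closed walk arises and \<open>P u\<close> itself is
  unchanged.\<close>

lemma branching_reattach:
  assumes P: "branching V E P" and "u \<in> V" "(u, v) \<in> E" and v: "v \<notin> set (P u)"
  shows "branching V E (reattach P u v)"
proof -
  let ?Q = "reattach P u v"
  obtain U where U: "P u = U @ [u]"
    using branching_last[OF P \<open>u \<in> V\<close>] by blast
  then have U_ne: "P u \<noteq> []" and U_last: "last (P u) = u"
    by auto
  have outside: "?Q x = []" if "x \<notin> V" for x
    using that branching_outside[OF P, of x] by (simp add: reattach_def)
  have ends: "\<exists>A. ?Q x = A @ [x]" if "x \<in> V" for x
  proof (cases "v \<in> set (P x)")
    case True
    then obtain A B where AB: "P x = A @ v # B" "v \<notin> set A"
      by (auto dest: split_list_first)
    have "last (v # B) = x"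
      using AB branching_last[OF P that] by (metis last_appendR last_snoc list.discI)
    then show ?thesis
      unfolding reattach_below[of P, OF AB]
      by (metis append.assoc append_butlast_last_id list.discI)
  qed (simp add: reattach_not_below branching_last[OF P that])
  have prefix: "?Q y = A @ [y]" if Q: "?Q x = A @ y # B" for x A y B
  proof (cases "v \<in> set (P x)")
    case False
    then have "P x = A @ y # B"
      using Q by (simp add: reattach_not_below)
    then have "P y = A @ [y]" "v \<notin> set (A @ [y])"
      using branching_prefix[OF P] False by auto
    then show ?thesis by (simp add: reattach_not_below)
  next
    case True
    then obtain A0 B0 where AB: "P x = A0 @ v # B0" "v \<notin> set A0"
      by (auto dest: split_list_first)
    have eq: "P u @ v # B0 = A @ y # B"
      using Q reattach_below[of P, OF AB] by simp
    \<comment> \<open>Either \<open>y\<close> lies on \<open>P u\<close>, whose vertices keep their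
      paths, or it lies in the moved segment starting at \<open>v\<close>, where the old prefix up
      to \<open>y\<close> is transported.\<close>
    then consider C where "P u = A @ y # C" | C where "A = P u @ C" "v # B0 = C @ y # B"
      by (auto simp: append_eq_append_conv2 append_eq_Cons_conv Cons_eq_append_conv)
    then show ?thesis
    proof cases
      case 1
      then have "P y = A @ [y]" "v \<notin> set (A @ [y])"
        using branching_prefix[OF P] v by auto
      then show ?thesis by (simp add: reattach_not_below)
    next
      case 2
      have "P x = (A0 @ C) @ y # B"
        using AB 2 by simp
      then have Py: "P y = A0 @ C @ [y]"
        using branching_prefix[OF P] by fastforce
      obtain D where D: "C @ [y] = v # D"
        using 2(2) by (cases C) auto
      show ?thesis
        using reattach_below[of P y A0 v D u] Py D AB 2 by simp
    qed
  qed
  have arcs: "set (path_arcs (?Q x)) \<subseteq> E" for x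
  proof (cases "v \<in> set (P x)")
    case True
    then obtain A B where AB: "P x = A @ v # B" "v \<notin> set A"
      by (auto dest: split_list_first)
    show ?thesis
      unfolding reattach_below[of P, OF AB]
      using branching_arcs[OF P, of x] branching_arcs[OF P, of u] \<open>(u, v) \<in> E\<close>
      by (simp add: path_arcs_append[of _ v B] AB(1) path_arcs_snoc[of "P u" v] U_ne U_last)
  qed (simp add: reattach_not_below branching_arcs[OF P])
  show ?thesis
    unfolding branching_def using outside ends prefix arcs by blast
qed

section \<open>Path weights and branchings of maximal total weight\<close>

definition path_weight :: "('a \<times> 'a \<Rightarrow> real) \<Rightarrow> 'a list \<Rightarrow> real" where
  "path_weight w xs = (\<Sum>e\<leftarrow>path_arcs xs. w e)"

lemma path_weight_append:
  "path_weight w (xs @ y # ys) = path_weight w (xs @ [y]) + path_weight w (y # ys)"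
  by (simp add: path_weight_def path_arcs_append[of xs y ys])

lemma path_weight_snoc:
  "xs \<noteq> [] \<Longrightarrow> path_weight w (xs @ [y]) = path_weight w xs + w (last xs, y)"
  by (simp add: path_weight_def path_arcs_snoc)

text \<open>All paths through \<open>v\<close> share the same initial part up to \<open>v\<close>,
  so all change by the same amount.\<close>

lemma path_weight_reattach:
  assumes P: "branching V E P" and "u \<in> V" and "v \<in> set (P x)"
  shows "path_weight w (reattach P u v x)
    = path_weight w (P x) + (path_weight w (P u) + w (u, v) - path_weight w (P v))"
proof -
  obtain A B where AB: "P x = A @ v # B" "v \<notin> set A"
    using assms(3) by (auto dest: split_list_first)
  have Pv: "P v = A @ [v]"
    by (rule branching_prefix[OF P AB(1)])
  obtain U where U: "P u = U @ [u]"
    using branching_last[OF P \<open>u \<in> V\<close>] by blast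
  have "path_weight w (P u @ [v]) = path_weight w (P u) + w (u, v)"
    using path_weight_snoc[of "P u" w v] by (simp add: U)
  then show ?thesis
    unfolding reattach_below[of P, OF AB]
    by (simp add: path_weight_append[of w _ v B] AB(1) Pv)
qed

text \<open>At a maximum of the total path weight, a violated inequality would make reattaching
  \<open>v\<close> below \<open>u\<close> a strict gain for \<open>v\<close> and a loss for no
  vertex.\<close>

lemma ex_optimal_branching:
  assumes "finite V" "E \<subseteq> V \<times> V"
  obtains P where "branching V E P"
    and "\<And>u v. (u, v) \<in> E \<Longrightarrow> v \<notin> set (P u) \<Longrightarrow>
      path_weight w (P u) + w (u, v) \<le> path_weight w (P v)"
proof -
  define total where "total P = (\<Sum>x\<in>V. path_weight w (P x))" for P
  have fin: "finite {P. branching V E P}"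
    by (rule finite_branchings[OF \<open>finite V\<close>])
  have "{P. branching V E P} \<noteq> {}"
    using branching_singletons by blast
  with fin obtain P where P: "branching V E P"
    and "Max (total ` {P. branching V E P}) = total P"
    using obtains_MAX[of "{P. branching V E P}" total] by blast
  with fin have max: "total Q \<le> total P" if "branching V E Q" for Q
    using that by (metis Max_ge finite_imageI imageI mem_Collect_eq)
  have "path_weight w (P u) + w (u, v) \<le> path_weight w (P v)"
    if "(u, v) \<in> E" "v \<notin> set (P u)" for u v
  proof (rule ccontr)
    assume less: "\<not> ?thesis"
    have V: "u \<in> V" "v \<in> V"
      using assms(2) that(1) by auto
    have le: "path_weight w (P x) \<le> path_weight w (reattach P u v x)" for x
      using path_weight_reattach[OF P V(1), of v x w] less
      by (cases "v \<in> set (P x)") (auto simp: reattach_not_below)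
    have "v \<in> set (P v)"
      using branching_last[OF P V(2)] by auto
    then have "path_weight w (P v) < path_weight w (reattach P u v v)"
      using path_weight_reattach[OF P V(1), of v v w] less by auto
    then have "total P < total (reattach P u v)"
      unfolding total_def using le V(2) \<open>finite V\<close> by (intro sum_strict_mono_ex1) auto
    then show False
      using max[OF branching_reattach[OF P V(1) that]] by simp
  qed
  with P that show thesis by blast
qed

section \<open>Residues\<close>

text \<open>The window lies strictly between \<open>0\<close> and \<open>r\<close>, so the shifted
  \<open>x\<close> is its own residue and the residue of \<open>- x\<close> is its reflection in
  \<open>r\<close>.\<close>

lemma rmod_bounds_of_window:
  fixes k :: int
  assumes "0 < a" "0 < b" "a \<le> x + of_int k * r" "x + of_int k * r \<le> r - b"
  shows "a \<le> x rmod r" "b \<le> (- x) rmod r"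
proof -
  have "x rmod r = x + of_int k * r"
    using assms by (intro rmod_unique[where n = "- k"]) auto
  then show "a \<le> x rmod r" using assms by simp
  have "(- x) rmod r = r - (x + of_int k * r)"
    using assms by (intro rmod_unique[where n = "k - 1"]) (auto simp: algebra_simps)
  then show "b \<le> (- x) rmod r" using assms by simp
qed

text \<open>If adding \<open>a\<close> to the residue of \<open>x\<close> does not wrap around, the
  sum is positive, hence at least \<open>L\<close>, which leaves at least \<open>b\<close>. If it
  wraps, the result is below \<open>a < L\<close>, hence \<open>0\<close>, and the residue of
  \<open>x\<close> is exactly \<open>r - a\<close>.\<close>

lemma window_of_rmod_shift:
  assumes "0 < r" "0 < a" "0 < b" "a + b \<le> L" "L \<le> r"
    and "(x + a) rmod r = 0 \<or> L \<le> (x + a) rmod r"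
  shows "b \<le> x rmod r \<and> x rmod r \<le> r - a"
proof -
  let ?y = "x rmod r"
  have y: "0 \<le> ?y" "?y < r"
    using assms(1) by (simp_all add: rmod_nonneg rmod_less)
  have x: "x = ?y + of_int \<lfloor>x / r\<rfloor> * r"
    using assms(1) by (simp add: rmod_def)
  show ?thesis
  proof (cases "?y + a < r")
    case True
    have "(x + a) rmod r = ?y + a"
      using True y assms x by (intro rmod_unique[where n = "\<lfloor>x / r\<rfloor>"]) auto
    then show ?thesis
      using True y assms by linarith
  next
    case False
    have "(x + a) rmod r = ?y + a - r"
      using False y assms x
      by (intro rmod_unique[where n = "\<lfloor>x / r\<rfloor> + 1"]) (auto simp: algebra_simps)
    then show ?thesis
      using False y assms by linarith
  qed
qed

section \<open>Colorings and breaker functions\<close>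

context weighted_sym_digraph
begin

lemma arc_sym: "(u, v) \<in> parcs G \<Longrightarrow> (v, u) \<in> parcs G"
  using pair_sym_arcs unfolding symmetric_def by (auto dest: symD)

lemma digon_weight_le:
  assumes "(u, v) \<in> parcs G"
  shows "c (u, v) + c (v, u) \<le> max_digon_weight G c"
proof -
  have "{c (x, y) + c (y, x) | x y. (x, y) \<in> parcs G}
      = (\<lambda>(x, y). c (x, y) + c (y, x)) ` parcs G"
    by (auto simp: image_iff)
  then have "finite {c (x, y) + c (y, x) | x y. (x, y) \<in> parcs G}"
    using pair_finite_arcs by simp
  then show ?thesis
    unfolding max_digon_weight_def using assms by (auto intro!: Max_ge)
qed

text \<open>Since \<open>arc_total c C\<close> is positive, the right side fails when
  \<open>arc_total T C = 0\<close>, in agreement with the value \<open>\<infinity>\<close>.\<close>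

lemma dicycle_ratio_le_iff:
  assumes "cycle C"
  shows "dicycle_ratio c T C \<le> ereal r \<longleftrightarrow> arc_total c C \<le> r * real (arc_total T C)"
proof -
  have "C \<noteq> []" "set C \<subseteq> parcs G"
    using assms unfolding cycle_def awalk_def by auto
  then have "0 < arc_total c C"
    unfolding arc_total_def using weight_pos by (intro sum_pos) auto
  then show ?thesis
    by (auto simp: dicycle_ratio_def field_simps)
qed

lemma breaker_function_of_coloring:
  assumes \<phi>: "circular_coloring G c r \<phi>"
  obtains T where "breaker_function G T"
    and "\<And>C. cycle C \<Longrightarrow> arc_total c C \<le> r * real (arc_total T C)"
proof
  define T :: "'a \<times> 'a \<Rightarrow> nat" where "T e = (if \<phi> (fst e) > \<phi> (snd e) then 1 else 0)" for e
  have ineq: "c e \<le> \<phi> (snd e) - \<phi> (fst e) + r * real (T e)" and neq: "\<phi> (fst e) \<noteq> \<phi> (snd e)"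
    if e: "e \<in> parcs G" for e
  proof -
    obtain u v where uv: "e = (u, v)" by (cases e)
    have "u \<in> pverts G" "v \<in> pverts G"
      using e uv wellformed' by auto
    then have range: "\<phi> u \<in> {0..<r}" "\<phi> v \<in> {0..<r}"
      using \<phi> unfolding circular_coloring_def by auto
    have le: "c e \<le> (\<phi> v - \<phi> u) rmod r"
      using \<phi> e uv unfolding circular_coloring_def circ_dist_def by auto
    \<comment> \<open>The difference lies strictly between \<open>- r\<close> and \<open>r\<close>,
      and \<open>T\<close> records the single turn needed when it is negative.\<close>
    have "(\<phi> v - \<phi> u) rmod r = \<phi> v - \<phi> u + r * real (T e)"
      using range uv
      by (intro rmod_unique[where n = "- int (T e)"]) (auto simp: T_def)
    with le uv show "c e \<le> \<phi> (snd e) - \<phi> (fst e) + r * real (T e)" by simp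
    show "\<phi> (fst e) \<noteq> \<phi> (snd e)"
      using le uv weight_pos[OF e] by auto
  qed
  show "breaker_function G T"
    unfolding breaker_function_def
  proof (intro conjI ballI, safe)
    fix u v assume "(u, v) \<in> parcs G"
    then show "T (u, v) + T (v, u) = 1"
      using neq[of "(u, v)"] by (auto simp: T_def)
  qed (auto simp: T_def split: if_splits)
  show "arc_total c C \<le> r * real (arc_total T C)" if C: "cycle C" for C
  proof -
    obtain u where "pcas u C u" and sub: "set C \<subseteq> parcs G"
      using C unfolding cycle_def awalk_def by auto
    then have 0: "(\<Sum>e\<leftarrow>C. \<phi> (snd e) - \<phi> (fst e)) = 0"
      using sum_list_pcas_telescope[of u C u \<phi>] by simp
    have "arc_total c C = (\<Sum>e\<leftarrow>C. c e)"
      by (rule arc_total_cycle[OF C])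
    also have "\<dots> \<le> (\<Sum>e\<leftarrow>C. (\<phi> (snd e) - \<phi> (fst e)) + r * real (T e))"
      using sub ineq by (intro sum_list_mono) auto
    also have "\<dots> = r * (\<Sum>e\<leftarrow>C. real (T e))"
      using 0 by (simp add: sum_list_addf sum_list_const_mult)
    also have "(\<Sum>e\<leftarrow>C. real (T e)) = real (arc_total T C)"
      using arc_total_cycle[OF C, of "\<lambda>e. real (T e)"] by (simp add: arc_total_def)
    finally show ?thesis .
  qed
qed

lemma coloring_of_breaker_function:
  assumes r: "0 < r" "max_digon_weight G c \<le> r"
    and T: "breaker_function G T"
    and cyc: "\<And>C. cycle C \<Longrightarrow> 0 < arc_total c C rmod r \<Longrightarrow>
      arc_total c C rmod r < max_digon_weight G c \<Longrightarrow> arc_total c C \<le> r * real (arc_total T C)"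
  shows "\<exists>\<phi>. circular_coloring G c r \<phi>"
proof -
  define w where "w e = c e - r * real (T e)" for e
  have "parcs G \<subseteq> pverts G \<times> pverts G"
    using wellformed' by auto
  from ex_optimal_branching[OF pair_finite_verts this, of w]
  obtain P where P: "branching (pverts G) (parcs G) P"
    and opt: "\<And>u v. (u, v) \<in> parcs G \<Longrightarrow> v \<notin> set (P u) \<Longrightarrow>
      path_weight w (P u) + w (u, v) \<le> path_weight w (P v)"
    by blast
  define f where "f v = path_weight w (P v)" for v
  \<comment> \<open>Symmetric in \<open>u\<close> and \<open>v\<close>: both arcs of a digon are
    treated at once.\<close>
  let ?ok = "\<lambda>u v. c (u, v) \<le> (f v - f u) rmod r \<and> c (v, u) \<le> (f u - f v) rmod r"

  have T_sum: "real (T (u, v)) + real (T (v, u)) = 1" if "(u, v) \<in> parcs G" for u v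
    using T that unfolding breaker_function_def by (metis (mono_tags, lifting) case_prodD of_nat_1 of_nat_add)
  have neq: "u \<noteq> v" if "(u, v) \<in> parcs G" for u v
    using T_sum[OF that] by (cases "T (u, v)") auto
  \<comment> \<open>Otherwise \<open>P u\<close> would be a prefix of \<open>P v\<close> containing
    \<open>v\<close> before \<open>u\<close>, and \<open>v\<close> would occur twice on
    \<open>P v\<close>.\<close>
  have no_both: "u \<notin> set (P v)" if "v \<in> set (P u)" "u \<noteq> v" for u v
  proof
    assume "u \<in> set (P v)"
    then obtain A B where "P v = A @ u # B" by (auto dest: split_list)
    then have "P u = A @ [u]" by (rule branching_prefix[OF P])
    then have "v \<in> set A" using that by auto
    moreover have "\<exists>D. P v = D @ [v]"
      using branching_last[OF P] branching_subset[OF P] that(1) by blast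
    moreover have "distinct (P v)" by (rule branching_distinct[OF P])
    ultimately show False
      using \<open>P v = A @ u # B\<close> \<open>u \<noteq> v\<close> by (cases B rule: rev_cases) auto
  qed
  \<comment> \<open>The two values of \<open>T\<close> sum to \<open>1\<close>, so the two
    inequalities place \<open>f v - f u + r * T (u, v)\<close> between \<open>c (u, v)\<close> and
    \<open>r - c (v, u)\<close>.\<close>
  have two_sided: "?ok u v"
    if "(u, v) \<in> parcs G" "f u + w (u, v) \<le> f v" "f v + w (v, u) \<le> f u" for u v
  proof -
    have "r * real (T (u, v)) + r * real (T (v, u)) = r"
      using T_sum[OF that(1)] by (metis distrib_left mult.right_neutral)
    then show ?thesis
      using rmod_bounds_of_window[of "c (u, v)" "c (v, u)" "f v - f u" "int (T (u, v))" r]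
        weight_pos[OF that(1)] weight_pos[OF arc_sym[OF that(1)]] that
      by (simp add: w_def algebra_simps)
  qed
  have ok_back: "?ok u v" if uv: "(u, v) \<in> parcs G" and v: "v \<in> set (P u)" for u v
  proof -
    have vu: "(v, u) \<in> parcs G" using arc_sym[OF uv] .
    obtain A B where AB: "P u = A @ v # B" using v by (auto dest: split_list)
    have "last (v # B) = u"
      using AB branching_last[OF P in_arcsD1[OF uv]] by (metis last_appendR last_snoc list.discI)
    define C where "C = path_arcs (v # B @ [v])"
    have arcs_C: "C = path_arcs (v # B) @ [(u, v)]"
      using path_arcs_snoc[of "v # B" v] \<open>last (v # B) = u\<close> by (simp add: C_def)
    have "set (path_arcs (v # B)) \<subseteq> parcs G"
      using branching_arcs[OF P, of u] by (simp add: AB path_arcs_append[of A v B])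
    then have "set C \<subseteq> parcs G"
      using uv by (simp add: arcs_C)
    then have C: "cycle C"
      unfolding C_def using branching_distinct[OF P, of u] AB by (intro cycle_path_arcs) auto
    have "f u = f v + path_weight w (v # B)"
      using branching_prefix[OF P AB] by (simp add: f_def AB path_weight_append[of w A v B])
    then have "f u - f v + w (u, v) = (\<Sum>e\<leftarrow>C. w e)"
      by (simp add: arcs_C path_weight_def)
    also have "\<dots> = arc_total w C"
      by (rule arc_total_cycle[OF C, symmetric])
    also have "\<dots> = arc_total c C - r * real (arc_total T C)"
      by (simp add: arc_total_def w_def sum_subtractf sum_distrib_left)
    finally have weight: "f u - f v + w (u, v) = arc_total c C - r * real (arc_total T C)" .
    have le_vu: "f v + w (v, u) \<le> f u"
      using opt[OF vu no_both[OF v neq[OF uv]]] by (simp add: f_def)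
    show ?thesis
    proof (cases "0 < arc_total c C rmod r \<and> arc_total c C rmod r < max_digon_weight G c")
      case True
      then have "f u + w (u, v) \<le> f v"
        using cyc[OF C] weight by simp
      then show ?thesis by (rule two_sided[OF uv _ le_vu])
    next
      case False
      \<comment> \<open>Passing from \<open>w\<close> back to \<open>c\<close> adds integer
        multiples of \<open>r\<close> only, which the residue does not see.\<close>
      let ?k = "int (T (u, v)) - int (arc_total T C)"
      have "f u - f v + c (u, v) = arc_total c C + of_int ?k * r"
        using weight by (simp add: w_def algebra_simps)
      then have "(f u - f v + c (u, v)) rmod r = arc_total c C rmod r"
        using rmod_add[of "arc_total c C" r "of_int ?k * r"] rmod_self_multiple_int[of ?k r]
        by (simp del: of_int_diff)
      then have "(f u - f v + c (u, v)) rmod r = 0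
          \<or> max_digon_weight G c \<le> (f u - f v + c (u, v)) rmod r"
        using False rmod_nonneg[of r "arc_total c C"] r by auto
      from window_of_rmod_shift[OF r(1) weight_pos[OF uv] weight_pos[OF vu] digon_weight_le[OF uv] r(2) this]
      have win: "c (v, u) \<le> (f u - f v) rmod r" "(f u - f v) rmod r \<le> r - c (u, v)"
        by auto
      then have "c (u, v) \<le> (- (f u - f v)) rmod r"
        using r(1) weight_pos[OF uv] weight_pos[OF vu]
        by (intro rmod_bounds_of_window(2)[where a = "c (v, u)" and k = "- \<lfloor>(f u - f v) / r\<rfloor>"])
          (auto simp: rmod_def algebra_simps)
      with win show ?thesis by simp
    qed
  qed
  have ok: "?ok u v" if uv: "(u, v) \<in> parcs G" for u v
  proof -
    consider "v \<in> set (P u)" | "u \<in> set (P v)" | "v \<notin> set (P u)" "u \<notin> set (P v)" by blast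
    then show ?thesis
    proof cases
      case 1
      then show ?thesis by (rule ok_back[OF uv])
    next
      case 2
      then show ?thesis using ok_back[OF arc_sym[OF uv]] by simp
    next
      case 3
      then show ?thesis
        using two_sided[OF uv] opt[OF uv] opt[OF arc_sym[OF uv]] by (simp add: f_def)
    qed
  qed
  have "circular_coloring G c r (\<lambda>v. f v rmod r)"
    unfolding circular_coloring_def circ_dist_def
    using r(1) ok by (auto simp: rmod_diff rmod_nonneg rmod_less)
  then show ?thesis by blast
qed

end

theorem theorem1:
  fixes G :: "'a pair_pre_digraph" and c :: "'a \<times> 'a \<Rightarrow> real" and r :: real
  assumes "weighted_sym_digraph G c"
    and "r > 0"
    and "r \<ge> max_digon_weight G c"
  shows "(\<exists>\<phi>. circular_coloring G c r \<phi>) \<longleftrightarrow>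
    (\<exists>T. breaker_function G T \<and>
      (SUP C \<in> {C. dicycle G C \<and> 0 < arc_total c C rmod r \<and>
                   arc_total c C rmod r < max_digon_weight G c}.
         dicycle_ratio c T C) \<le> ereal r)"
proof -
  interpret weighted_sym_digraph G c by fact
  show ?thesis
  proof
    assume "\<exists>\<phi>. circular_coloring G c r \<phi>"
    then obtain \<phi> where "circular_coloring G c r \<phi>" ..
    then obtain T where "breaker_function G T"
      and "\<And>C. cycle C \<Longrightarrow> arc_total c C \<le> r * real (arc_total T C)"
      by (rule breaker_function_of_coloring) blast
    then show "\<exists>T. breaker_function G T \<and>
      (SUP C \<in> {C. dicycle G C \<and> 0 < arc_total c C rmod r \<and>
                   arc_total c C rmod r < max_digon_weight G c}.
         dicycle_ratio c T C) \<le> ereal r"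
      \<comment> \<open>If no dicycle meets the residue condition, the supremum in
        \<open>ereal\<close> is \<open>-\<infinity>\<close> and the bound holds trivially.\<close>
      by (intro exI[of _ T] conjI SUP_least) (auto simp: dicycle_ratio_le_iff)
  next
    assume "\<exists>T. breaker_function G T \<and>
      (SUP C \<in> {C. dicycle G C \<and> 0 < arc_total c C rmod r \<and>
                   arc_total c C rmod r < max_digon_weight G c}.
         dicycle_ratio c T C) \<le> ereal r"
    then obtain T where "breaker_function G T"
      and "\<And>C. cycle C \<Longrightarrow> 0 < arc_total c C rmod r \<Longrightarrow>
        arc_total c C rmod r < max_digon_weight G c \<Longrightarrow> arc_total c C \<le> r * real (arc_total T C)"
      by (auto simp: SUP_le_iff dicycle_ratio_le_iff)
    then show "\<exists>\<phi>. circular_coloring G c r \<phi>"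
      by (rule coloring_of_breaker_function[OF assms(2,3)])
  qed
qed

end
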